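(* Let $f:\mathbb{R}\to\mathbb{R}$ be a smooth function with $f(0)=f(1)=0$, $f'(0)>0$, $f'(1)<0$ and $f''(u)<0$ for all $u\in\mathbb{R}$, and let $c\ge 2\sqrt{f'(0)}$. Let $H_c$ be the heteroclinic orbit of the planar system $$\dot u=v,\qquad \dot v=-cv-f(u)$$ connecting the critical points $(0,0)$ and $(1,0)$, and define $$\underline\lambda:=\frac{c-\sqrt{c^2-4f'(0)}}{2f'(0)},\qquad \overline\lambda:=\frac{c-\sqrt{c^2-4f'(1)}}{2f'(1)}.$$ Then $H_c$ can be parametrized as $H_c=\{(u,h_c(u)) : u\in[0,1]\}$ for some function $h_c$, and for all $u\in(0,1)$ $$-\underline\lambda\, f(u)<h_c(u)<-\overline\lambda\, f(u)<0.$$ Moreover, if $(u_c(s),v_c(s))$, $s\in\mathbb{R}$, is the time parametrization of $H_c$ (as a solution of the system) such that $u_c(0)=1/2$, then for all $s\in\mathbb{R}$ $$u_c(s)\in\left\langle z_{\underline\lambda}(s),\,z_{\overline\lambda}(s)\right\rangle,$$ where $u=z_\lambda(s)$ denotes the solution of the Cauchy problem $$\frac{du}{ds}=-\lambda f(u),\qquad u(0)=\frac12 .$$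
   Context: The dot denotes the derivative with respect to $s$. Under the stated hypotheses, $(1,0)$ is a saddle point and $(0,0)$ is an attracting node of the system. The heteroclinic orbit $H_c$ is the branch of the unstable separatrix of the saddle $(1,0)$ that tends to $(0,0)$ as $s\to+\infty$ (and to $(1,0)$ as $s\to-\infty$); when $H_c$ is written as a set parametrized by $u\in[0,1]$, the two critical points (the endpoints $u=0$ and $u=1$) are included. For real numbers $a,b$, $\langle a,b\rangle$ denotes the smallest closed interval containing $a$ and $b$. *)

theory Defs
  imports "HOL-Analysis.Analysis"
begin

definition smooth_fun :: "(real \<Rightarrow> real) \<Rightarrow> bool" where
  "smooth_fun f \<longleftrightarrow> (\<forall>n x. (deriv ^^ n) f field_differentiable (at x))"

definition solves_system ::
  "(real \<Rightarrow> real) \<Rightarrow> real \<Rightarrow> (real \<Rightarrow> real) \<Rightarrow> (real \<Rightarrow> real) \<Rightarrow> bool" where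
  "solves_system f c u v \<longleftrightarrow>
     (\<forall>s. (u has_real_derivative v s) (at s) \<and>
          (v has_real_derivative (- c * v s - f (u s))) (at s))"

text \<open>
  A solution that tends to the saddle \<open>(1, 0)\<close> as \<open>s \<rightarrow> -\<infinity>\<close> and to the node \<open>(0, 0)\<close> as
  \<open>s \<rightarrow> +\<infinity>\<close> is a time parametrization of the heteroclinic orbit. The limit at \<open>-\<infinity>\<close> places it on
  the unstable separatrix of the saddle. As a point set, the orbit includes the two critical points,
  which are not attained at finite time.
\<close>

definition time_parametrization ::
  "(real \<Rightarrow> real) \<Rightarrow> real \<Rightarrow> (real \<times> real) set \<Rightarrow> (real \<Rightarrow> real) \<Rightarrow> (real \<Rightarrow> real) \<Rightarrow> bool" where
  "time_parametrization f c H u v \<longleftrightarrow>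
     solves_system f c u v \<and>
     ((\<lambda>s. (u s, v s)) \<longlongrightarrow> (1, 0)) at_bot \<and>
     ((\<lambda>s. (u s, v s)) \<longlongrightarrow> (0, 0)) at_top \<and>
     H = {(0, 0), (1, 0)} \<union> range (\<lambda>s. (u s, v s))"

definition heteroclinic_orbit :: "(real \<Rightarrow> real) \<Rightarrow> real \<Rightarrow> (real \<times> real) set \<Rightarrow> bool" where
  "heteroclinic_orbit f c H \<longleftrightarrow> (\<exists>u v. time_parametrization f c H u v)"

definition lambda_lower :: "(real \<Rightarrow> real) \<Rightarrow> real \<Rightarrow> real" where
  "lambda_lower f c = (c - sqrt (c\<^sup>2 - 4 * deriv f 0)) / (2 * deriv f 0)"

definition lambda_upper :: "(real \<Rightarrow> real) \<Rightarrow> real \<Rightarrow> real" where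
  "lambda_upper f c = (c - sqrt (c\<^sup>2 - 4 * deriv f 1)) / (2 * deriv f 1)"

text \<open>
  The solution on all of \<open>\<real>\<close> of \<open>du/ds = -\<lambda> f(u)\<close>, \<open>u(0) = 1/2\<close>. For smooth \<open>f\<close> vanishing at
  \<open>0\<close> and \<open>1\<close> it exists and is unique, since the equilibria confine it to the interval \<open>(0, 1)\<close>.
\<close>

definition cauchy_solution :: "(real \<Rightarrow> real) \<Rightarrow> real \<Rightarrow> real \<Rightarrow> real" where
  "cauchy_solution f l =
     (THE z. z 0 = 1/2 \<and> (\<forall>s. (z has_real_derivative (- l * f (z s))) (at s)))"

end

theory Submission
  imports Defs
begin

text \<open>
  For \<open>\<lambda> > 0\<close> put \<open>w = v + \<lambda> f(u)\<close> along the orbit. Then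
  \<open>w' + (c - \<lambda> f'(u)) w = - f(u) (\<lambda>\<^sup>2 f'(u) - c \<lambda> + 1)\<close>. The lower and upper \<open>\<lambda>\<close> are the roots of the
  quadratic factor for \<open>f'(0)\<close> and \<open>f'(1)\<close>, so, as \<open>f'\<close> decreases, the right-hand side is positive
  for the former and negative for the latter as long as \<open>0 < u < 1\<close>. Since \<open>w\<close> vanishes at
  \<open>-\<infinity>\<close>, where \<open>c - \<lambda> f'(u)\<close> is positive, an integrating factor gives the sign of \<open>w\<close> and
  thereby both bounds on \<open>v\<close>. The confinement \<open>0 < u < 1\<close> comes from the maximum principle at
  \<open>u = 1\<close> and from the lower bound \<open>v \<ge> -\<lambda> f(u)\<close>, which prevents \<open>u\<close> from leaving \<open>1\<close> or reaching
  \<open>0\<close> in finite time. Finally, the ratio \<open>-v / f(u)\<close> is bounded between the two values of \<open>\<lambda>\<close>; a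
  time change with this rate turns \<open>u\<close> into the solutions of the scalar Cauchy problems, which makes
  the comparison with \<open>u\<close> a comparison of times.
\<close>

section \<open>Linear differential inequalities\<close>

lemma antiderivative_on_UNIV:
  fixes k :: "real \<Rightarrow> real"
  assumes "\<And>t. isCont k t"
  obtains A where "\<And>t. (A has_real_derivative k t) (at t)"
proof -
  have "\<exists>A. \<forall>t::real. -\<infinity> < ereal t \<longrightarrow> ereal t < \<infinity> \<longrightarrow> (A has_vector_derivative k t) (at t)"
    using assms by (intro einterval_antiderivative) auto
  then show ?thesis
    using that by (auto simp: has_real_derivative_iff_has_vector_derivative)
qed

text \<open>With the integrating factor \<open>exp (A t)\<close>, the product
  \<open>exp (A t) * w t\<close> has derivative \<open>exp (A t) * (w' t + k t * w t)\<close>. The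
  open interval admits endpoints at which the inequality is not known.\<close>

lemma linear_differential_inequality:
  fixes w :: "real \<Rightarrow> real"
  assumes "\<And>t. (A has_real_derivative k t) (at t)"
    and "\<And>t. (w has_real_derivative w' t) (at t)"
    and "\<And>t. \<lbrakk>a < t; t < b\<rbrakk> \<Longrightarrow> 0 \<le> w' t + k t * w t" and "a \<le> b"
  shows "exp (A a) * w a \<le> exp (A b) * w b"
proof (rule DERIV_nonneg_imp_increasing_open[OF \<open>a \<le> b\<close>])
  note [derivative_intros] = DERIV_chain2[OF assms(1)] DERIV_chain2[OF assms(2)]
  have D: "((\<lambda>t. exp (A t) * w t) has_real_derivative exp (A t) * (w' t + k t * w t)) (at t)" for t
    by (auto intro!: derivative_eq_intros simp: algebra_simps)
  show "\<exists>y. ((\<lambda>t. exp (A t) * w t) has_real_derivative y) (at t) \<and> 0 \<le> y" if "a < t" "t < b" for t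
    using D[of t] assms(3)[OF that] by auto
  show "continuous_on {a..b} (\<lambda>t. exp (A t) * w t)"
    using DERIV_isCont[OF D] by (auto intro: continuous_at_imp_continuous_on)
qed

text \<open>Since \<open>k\<close> is eventually nonnegative at \<open>-\<infinity>\<close>, the
  factor \<open>exp (A t)\<close> stays bounded there. So \<open>exp (A t) * w t\<close> starts from
  the limit 0 and is nondecreasing up to \<open>s\<close>.\<close>

lemma linear_differential_inequality_at_bot:
  fixes w :: "real \<Rightarrow> real"
  assumes k: "\<And>t. isCont k t" "eventually (\<lambda>t. 0 \<le> k t) at_bot"
    and w: "\<And>t. (w has_real_derivative w' t) (at t)" "(w \<longlongrightarrow> 0) at_bot"
    and pos: "\<And>t. t \<le> s \<Longrightarrow> 0 < w' t + k t * w t"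
  shows "0 < w s"
proof -
  obtain A where A: "\<And>t. (A has_real_derivative k t) (at t)"
    using antiderivative_on_UNIV[OF k(1)] by blast
  obtain N where N: "\<And>t. t \<le> N \<Longrightarrow> 0 \<le> k t"
    using k(2) by (auto simp: eventually_at_bot_linorder)
  have A_mono: "A t \<le> A N" if "t \<le> N" for t
    using that A N by (intro DERIV_nonneg_imp_nondecreasing[OF that]) force
  have lim: "((\<lambda>t. exp (A t) * w t) \<longlongrightarrow> 0) at_bot"
  proof (rule Lim_null_comparison)
    show "eventually (\<lambda>t. norm (exp (A t) * w t) \<le> exp (A N) * \<bar>w t\<bar>) at_bot"
      using eventually_le_at_bot[of N]
      by eventually_elim (auto simp: abs_mult intro!: mult_right_mono A_mono)
    show "((\<lambda>t. exp (A N) * \<bar>w t\<bar>) \<longlongrightarrow> 0) at_bot"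
      by (intro tendsto_mult_right_zero tendsto_rabs_zero w(2))
  qed
  have nonneg: "0 \<le> w t" if "t \<le> s" for t
  proof -
    have "eventually (\<lambda>r. exp (A r) * w r \<le> exp (A t) * w t) at_bot"
      using eventually_le_at_bot[of t]
      by eventually_elim
        (rule linear_differential_inequality[OF A w(1)], use pos that in \<open>auto intro: less_imp_le\<close>)
    then have "0 \<le> exp (A t) * w t"
      by (rule tendsto_upperbound[OF lim]) simp
    then show ?thesis
      by (simp add: zero_le_mult_iff)
  qed
  \<comment> \<open>At a zero, \<open>w' s\<close> would be positive and \<open>w\<close> negative
    just before \<open>s\<close>.\<close>
  moreover have "w s \<noteq> 0"
  proof
    assume "w s = 0"
    with pos[of s] have "0 < w' s" by simp
    from DERIV_pos_inc_left[OF w(1) this] obtain d where d: "d > 0" "\<And>h. \<lbrakk>0 < h; h < d\<rbrakk> \<Longrightarrow> w (s - h) < w s"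
      by auto
    from d(2)[of "d / 2"] nonneg[of "s - d / 2"] \<open>w s = 0\<close> \<open>d > 0\<close> show False by auto
  qed
  ultimately show ?thesis
    using order_le_less by force
qed

section \<open>Uniqueness for scalar autonomous equations\<close>

text \<open>Gronwall's argument: both solutions stay in a compact interval on \<open>{0..s}\<close>,
  where \<open>f\<close> is Lipschitz, so their squared distance grows at most exponentially from
  0.\<close>

lemma autonomous_ode_unique_forward:
  fixes y z :: "real \<Rightarrow> real"
  assumes f: "\<And>x. (f has_real_derivative f' x) (at x)" "\<And>x. isCont f' x"
    and y: "\<And>t. (y has_real_derivative l * f (y t)) (at t)"
    and z: "\<And>t. (z has_real_derivative l * f (z t)) (at t)"
    and "y 0 = z 0" and "0 \<le> s"
  shows "y s = z s"
proof -
  have cont: "continuous_on {0..s} y" "continuous_on {0..s} z"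
    using DERIV_isCont[OF y] DERIV_isCont[OF z] by (auto intro: continuous_at_imp_continuous_on)
  have "bounded (y ` {0..s} \<union> z ` {0..s})"
    using cont by (intro bounded_Un[THEN iffD2] conjI compact_imp_bounded compact_continuous_image) auto
  then obtain B where "\<forall>x \<in> y ` {0..s} \<union> z ` {0..s}. \<bar>x\<bar> \<le> B"
    by (auto simp only: bounded_iff real_norm_def)
  then have B: "y t \<in> {-B..B} \<and> z t \<in> {-B..B}" if "t \<in> {0..s}" for t
    using that by (simp add: ball_Un abs_le_iff minus_le_iff)
  have "compact (f' ` {-B..B})"
    using f(2) by (intro compact_continuous_image continuous_at_imp_continuous_on) auto
  then have "bounded (f' ` {-B..B})"
    by (rule compact_imp_bounded)
  then obtain L where L: "\<And>x. x \<in> {-B..B} \<Longrightarrow> \<bar>f' x\<bar> \<le> L"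
    by (auto simp only: bounded_iff real_norm_def image_iff)
  have lip: "\<bar>f p - f q\<bar> \<le> L * \<bar>p - q\<bar>" if "p \<in> {-B..B}" "q \<in> {-B..B}" for p q
    using field_differentiable_bound[of "{-B..B}" f f' L p q] that L
      has_field_derivative_at_within[OF f(1)] by simp
  \<comment> \<open>The squared distance is negated because the differential inequality yields lower
    bounds.\<close>
  define w where "w = (\<lambda>t. - (y t - z t)\<^sup>2)"
  have w: "(w has_real_derivative - 2 * (y t - z t) * (l * (f (y t) - f (z t)))) (at t)" for t
    unfolding w_def by (auto intro!: derivative_eq_intros y z simp: algebra_simps)
  define k where "k = - 2 * \<bar>l\<bar> * L"
  have "exp (k * 0) * w 0 \<le> exp (k * s) * w s"
  proof (rule linear_differential_inequality[OF _ w _ \<open>0 \<le> s\<close>])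
    show "((\<lambda>t. k * t) has_real_derivative k) (at t)" for t
      by (auto intro!: derivative_eq_intros)
    fix t assume t: "0 < t" "t < s"
    have "\<bar>(y t - z t) * (l * (f (y t) - f (z t)))\<bar> = \<bar>l\<bar> * (\<bar>y t - z t\<bar> * \<bar>f (y t) - f (z t)\<bar>)"
      by (simp add: abs_mult)
    also have "\<dots> \<le> \<bar>l\<bar> * (\<bar>y t - z t\<bar> * (L * \<bar>y t - z t\<bar>))"
      using B[of t] t by (intro mult_left_mono lip) auto
    also have "\<dots> = \<bar>l\<bar> * L * (y t - z t)\<^sup>2"
      by (simp add: power2_eq_square)
    finally show "0 \<le> - 2 * (y t - z t) * (l * (f (y t) - f (z t))) + k * w t"
      by (simp add: k_def w_def abs_le_iff algebra_simps)
  qed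
  moreover have "w 0 = 0"
    using \<open>y 0 = z 0\<close> by (simp add: w_def)
  ultimately have "0 \<le> w s"
    by (simp add: zero_le_mult_iff)
  then show ?thesis
    by (simp add: w_def)
qed

text \<open>Negative times reduce to positive ones by time reversal, which replaces \<open>l\<close>
  by \<open>- l\<close>.\<close>

lemma autonomous_ode_unique:
  fixes y z :: "real \<Rightarrow> real"
  assumes f: "\<And>x. (f has_real_derivative f' x) (at x)" "\<And>x. isCont f' x"
    and y: "\<And>t. (y has_real_derivative l * f (y t)) (at t)"
    and z: "\<And>t. (z has_real_derivative l * f (z t)) (at t)"
    and "y 0 = z 0"
  shows "y = z"
proof
  fix s
  show "y s = z s"
  proof (cases "0 \<le> s")
    case True
    with autonomous_ode_unique_forward[OF assms] show ?thesis .
  next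
    case False
    have "y (- (- s)) = z (- (- s))"
    proof (rule autonomous_ode_unique_forward[OF f, where l = "- l"
          and y = "\<lambda>t. y (- t)" and z = "\<lambda>t. z (- t)" and s = "- s"])
      show "((\<lambda>t. y (- t)) has_real_derivative - l * f (y (- t))) (at t)" for t
        using DERIV_chain2[OF y DERIV_minus[OF DERIV_ident], of t] by simp
      show "((\<lambda>t. z (- t)) has_real_derivative - l * f (z (- t))) (at t)" for t
        using DERIV_chain2[OF z DERIV_minus[OF DERIV_ident], of t] by simp
    qed (use False assms(5) in auto)
    then show ?thesis by simp
  qed
qed

section \<open>Travelling fronts of a concave nonlinearity\<close>

locale concave_nonlinearity =
  fixes f f' :: "real \<Rightarrow> real"
  assumes f_deriv: "(f has_real_derivative f' x) (at x)"
    and f'_cont: "isCont f' x"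
    and f'_anti: "x < y \<Longrightarrow> f' y < f' x"
    and f_0: "f 0 = 0" and f_1: "f 1 = 0"
    and f'_0: "0 < f' 0" and f'_1: "f' 1 < 0"
begin

lemma f_cont: "isCont f x"
  using f_deriv DERIV_isCont by blast

text \<open>By the mean value theorem, secant slopes are values of \<open>f'\<close> at intermediate
  points. The tangents at 0 and 1 later turn bounds on \<open>v\<close> into linear differential
  inequalities for \<open>u\<close>.\<close>

lemma f_le_tangent: "f y \<le> f x + f' x * (y - x)"
proof (cases x y rule: linorder_cases)
  case less
  then obtain z where "x < z" "f y - f x = (y - x) * f' z"
    using MVT2[of x y f f'] f_deriv by blast
  moreover have "(y - x) * f' z \<le> (y - x) * f' x"
    using f'_anti[of x z] less \<open>x < z\<close> by (intro mult_left_mono) auto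
  ultimately show ?thesis by (simp add: algebra_simps)
next
  case greater
  then obtain z where "z < x" "f x - f y = (x - y) * f' z"
    using MVT2[of y x f f'] f_deriv by blast
  moreover have "(x - y) * f' x \<le> (x - y) * f' z"
    using f'_anti[of z x] greater \<open>z < x\<close> by (intro mult_left_mono) auto
  ultimately show ?thesis by (simp add: algebra_simps)
qed auto

lemma f_neg: "1 < x \<Longrightarrow> f x < 0"
  using f_le_tangent[of x 1] f_1 f'_1 mult_neg_pos[of "f' 1" "x - 1"] by simp

text \<open>The secant from 0 to \<open>x\<close> is steeper than the one from \<open>x\<close> to
  1, so either the first rises or the second falls; each case makes \<open>f x\<close>
  positive.\<close>

lemma f_pos:
  assumes "0 < x" "x < 1"
  shows "0 < f x"
proof -
  obtain p where p: "0 < p" "p < x" "f x - f 0 = (x - 0) * f' p"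
    using MVT2[of 0 x f f'] f_deriv assms by blast
  obtain q where q: "x < q" "q < 1" "f 1 - f x = (1 - x) * f' q"
    using MVT2[of x 1 f f'] f_deriv assms by blast
  have "f' q < f' p" using f'_anti p q by simp
  then consider "0 < f' p" | "f' q < 0" by linarith
  then show ?thesis
    using p q assms f_0 f_1 mult_pos_pos[of x "f' p"] mult_pos_neg[of "1 - x" "f' q"] by cases auto
qed

end

text \<open>The equations for \<open>a\<close> and \<open>b\<close> say that
  \<open>- a * f' 0\<close> and \<open>- b * f' 1\<close> are eigenvalues of the linearization at
  the two critical points, so the curves \<open>v = - a * f u\<close> and
  \<open>v = - b * f u\<close> are tangent to eigenvectors there.\<close>

locale concave_front = concave_nonlinearity +
  fixes c a b :: real and u v :: "real \<Rightarrow> real"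
  assumes c_pos: "0 < c"
    and a: "0 < a" "a\<^sup>2 * f' 0 - c * a + 1 = 0"
    and b: "0 < b" "b\<^sup>2 * f' 1 - c * b + 1 = 0"
    and u_deriv: "(u has_real_derivative v s) (at s)"
    and v_deriv: "(v has_real_derivative - c * v s - f (u s)) (at s)"
    and u_bot: "(u \<longlongrightarrow> 1) at_bot" and v_bot: "(v \<longlongrightarrow> 0) at_bot"
    and u_top: "(u \<longlongrightarrow> 0) at_top"
begin

lemma u_cont: "isCont u s"
  using u_deriv DERIV_isCont by blast

lemma v_cont: "isCont v s"
  using v_deriv DERIV_isCont by blast

lemma u_continuous_on: "continuous_on S u"
  using u_cont by (intro continuous_at_imp_continuous_on) auto

section \<open>Height of the orbit above the curves \<open>v = - l * f u\<close>\<close>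

lemma a_poly_neg: "0 < x \<Longrightarrow> a\<^sup>2 * f' x - c * a + 1 < 0"
  using f'_anti[of 0 x] a mult_strict_left_mono[of "f' x" "f' 0" "a\<^sup>2"] zero_less_power[of a 2]
  by linarith

lemma b_poly_pos: "x < 1 \<Longrightarrow> 0 < b\<^sup>2 * f' x - c * b + 1"
  using f'_anti[of x 1] b mult_strict_left_mono[of "f' 1" "f' x" "b\<^sup>2"] zero_less_power[of b 2]
  by linarith

definition excess :: "real \<Rightarrow> real \<Rightarrow> real" where
  "excess l s = v s + l * f (u s)"

definition excess' :: "real \<Rightarrow> real \<Rightarrow> real" where
  "excess' l s = - c * v s - f (u s) + l * (f' (u s) * v s)"

lemma excess_deriv: "(excess l has_real_derivative excess' l s) (at s)"
  unfolding excess_def excess'_def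
  by (rule DERIV_add[OF v_deriv DERIV_cmult[OF DERIV_chain2[OF f_deriv u_deriv]]])

text \<open>The rate \<open>c - l * f' (u s)\<close> is the one for which all terms in
  \<open>v\<close> cancel, so that the sign of the right-hand side depends on \<open>u\<close>
  alone.\<close>

lemma excess'_eq:
  "excess' l s + (c - l * f' (u s)) * excess l s = f (u s) * - (l\<^sup>2 * f' (u s) - c * l + 1)"
  unfolding excess_def excess'_def by (simp add: algebra_simps power2_eq_square)

lemma rate_cont: "isCont (\<lambda>s. c - l * f' (u s)) s"
  by (intro continuous_intros isCont_o2[OF u_cont f'_cont])

lemma excess_bot: "(excess l \<longlongrightarrow> 0) at_bot"
proof -
  have "((\<lambda>s. v s + l * f (u s)) \<longlongrightarrow> 0 + l * f 1) at_bot"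
    by (intro tendsto_intros v_bot isCont_tendsto_compose[OF f_cont u_bot])
  then show ?thesis by (simp add: f_1 excess_def[abs_def])
qed

lemma rate_bot:
  assumes "0 < l"
  shows "eventually (\<lambda>s. 0 \<le> c - l * f' (u s)) at_bot"
proof -
  have "((\<lambda>s. c - l * f' (u s)) \<longlongrightarrow> c - l * f' 1) at_bot"
    by (intro tendsto_intros isCont_tendsto_compose[OF f'_cont u_bot])
  moreover have "0 < c - l * f' 1"
    using c_pos mult_pos_neg[OF assms f'_1] by linarith
  ultimately have "eventually (\<lambda>s. 0 < c - l * f' (u s)) at_bot"
    by (rule order_tendstoD(1))
  then show ?thesis
    by eventually_elim simp
qed

text \<open>Confinement is assumed only up to \<open>s\<close>, so that the bound is available while
  confinement is still being proved.\<close>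

lemma excess_a_pos:
  assumes "\<And>t. t \<le> s \<Longrightarrow> 0 < u t \<and> u t < 1"
  shows "0 < excess a s"
  by (rule linear_differential_inequality_at_bot[OF rate_cont rate_bot[OF a(1)] excess_deriv excess_bot])
    (unfold excess'_eq, use assms f_pos a_poly_neg in \<open>intro mult_pos_pos; force\<close>)

lemma excess_b_neg:
  assumes "\<And>t. t \<le> s \<Longrightarrow> 0 < u t \<and> u t < 1"
  shows "excess b s < 0"
proof -
  have "0 < - excess b s"
  proof (rule linear_differential_inequality_at_bot[OF rate_cont rate_bot[OF b(1)], where w = "\<lambda>t. - excess b t"])
    show "((\<lambda>t. - excess b t) has_real_derivative - excess' b t) (at t)" for t
      by (intro derivative_intros excess_deriv)
    show "((\<lambda>t. - excess b t) \<longlongrightarrow> 0) at_bot"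
      using tendsto_minus[OF excess_bot[of b]] by simp
    fix t assume "t \<le> s"
    then have "0 < f (u t) * (b\<^sup>2 * f' (u t) - c * b + 1)"
      using assms by (intro mult_pos_pos f_pos b_poly_pos) auto
    with excess'_eq[of b t] show "0 < - excess' b t + (c - b * f' (u t)) * - excess b t"
      unfolding mult_minus_right by linarith
  qed
  then show ?thesis by simp
qed

section \<open>Confinement of the orbit to \<open>0 < u < 1\<close>\<close>

text \<open>A value above 1 would force a global maximum \<open>u m > 1\<close>, since the limits at
  both ends are at most 1. There \<open>v m = 0\<close> and \<open>v' = - f (u m) > 0\<close>, so
  \<open>u\<close> would increase right after \<open>m\<close>.\<close>

lemma u_le_1: "u s \<le> 1"
proof (rule ccontr)
  assume "\<not> u s \<le> 1"
  then have s: "1 < u s" by simp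
  obtain N where N: "\<And>t. t \<le> N \<Longrightarrow> u t < u s"
    using order_tendstoD(2)[OF u_bot s] by (auto simp: eventually_at_bot_linorder)
  obtain M where M: "\<And>t. t \<ge> M \<Longrightarrow> u t < u s"
    using order_tendstoD(2)[OF u_top, of "u s"] s by (auto simp: eventually_at_top_linorder)
  have "s \<in> {N..M}" using N[of s] M[of s] by force
  then obtain m where m: "\<And>t. t \<in> {N..M} \<Longrightarrow> u t \<le> u m"
    using continuous_attains_sup[of "{N..M}" u] u_continuous_on by (metis compact_Icc empty_iff)
  have max: "u t \<le> u m" for t
    using m[of t] m[OF \<open>s \<in> {N..M}\<close>] N[of t] M[of t] by (cases "t \<in> {N..M}") force+
  have "v m = 0"
    by (rule DERIV_local_max[OF u_deriv zero_less_one]) (use max in auto)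
  moreover have "1 < u m" using max[of s] s by simp
  ultimately have "0 < - c * v m - f (u m)" using f_neg by simp
  from DERIV_pos_inc_right[OF v_deriv this] obtain d where
    d: "d > 0" "\<And>h. \<lbrakk>0 < h; h < d\<rbrakk> \<Longrightarrow> v m < v (m + h)" by auto
  have "u m < u (m + d / 2)"
  proof (rule DERIV_pos_imp_increasing_open[where f = u])
    show "m < m + d / 2" using d(1) by simp
    show "\<exists>y. (u has_real_derivative y) (at t) \<and> 0 < y" if "m < t" "t < m + d / 2" for t
      using u_deriv[of t] d(2)[of "t - m"] that \<open>v m = 0\<close> d(1) by auto
  qed (rule u_continuous_on)
  with max[of "m + d / 2"] show False by simp
qed

lemma u_less_1: "u s < 1"
proof (rule ccontr)
  assume "\<not> u s < 1"
  with u_le_1[of s] have s: "u s = 1" by simp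
  define Z where "Z = {t. u t = 1}"
  have "Z = u -` {1}" by (auto simp: Z_def)
  then have "closed Z"
    using continuous_closed_vimage[of "{1}" u] u_cont by simp
  obtain M where M: "\<And>t. t \<ge> M \<Longrightarrow> u t < 1"
    using order_tendstoD(2)[OF u_top, of 1] by (auto simp: eventually_at_top_linorder)
  then have bdd: "bdd_above Z"
    by (intro bdd_aboveI[of _ M], unfold Z_def) (metis less_irrefl linear mem_Collect_eq)
  \<comment> \<open>The last time at which \<open>u\<close> equals 1; it exists because
    \<open>Z\<close> is closed and \<open>u\<close> tends to 0 at
    \<open>+\<infinity>\<close>.\<close>
  define S where "S = Sup Z"
  have "S \<in> Z"
    unfolding S_def using s bdd \<open>closed Z\<close> by (intro closed_contains_Sup) (auto simp: Z_def)
  then have uS: "u S = 1" by (simp add: Z_def)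
  have after: "u t < 1" if "S < t" for t
    using cSup_upper[OF _ bdd, of t] u_le_1[of t] that by (force simp: S_def Z_def)
  have "v S = 0"
    by (rule DERIV_local_max[OF u_deriv zero_less_one]) (use u_le_1 uS in auto)
  have "eventually (\<lambda>t. 0 < u t) (at S)"
    using u_cont[of S] uS by (intro order_tendstoD(1)) (auto simp: isCont_def)
  then obtain d where d: "d > 0" "\<And>t. \<lbrakk>t \<noteq> S; dist t S < d\<rbrakk> \<Longrightarrow> 0 < u t"
    by (auto simp: eventually_at)
  obtain A where A: "\<And>t. (A has_real_derivative c - a * f' (u t)) (at t)"
    using antiderivative_on_UNIV[OF rate_cont] by blast
  \<comment> \<open>The excess is 0 at \<open>S\<close>, as \<open>v S = 0\<close> and
    \<open>f 1 = 0\<close>, and \<open>0 < u < 1\<close> just after \<open>S\<close>.\<close>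
  have nonneg: "0 \<le> excess a t" if "S < t" "t < S + d" for t
  proof -
    have "exp (A S) * excess a S \<le> exp (A t) * excess a t"
    proof (rule linear_differential_inequality[OF A excess_deriv])
      fix r assume "S < r" "r < t"
      then have "0 < u r" "u r < 1"
        using after d(2)[of r] that by (auto simp: dist_real_def)
      then show "0 \<le> excess' a r + (c - a * f' (u r)) * excess a r"
        unfolding excess'_eq using f_pos[of "u r"] a_poly_neg[of "u r"] by (intro mult_nonneg_nonneg) auto
    qed (use that in simp)
    then show ?thesis
      using uS \<open>v S = 0\<close> f_1 by (simp add: excess_def zero_le_mult_iff)
  qed
  \<comment> \<open>The slope, times \<open>a\<close>, of the tangent of \<open>f\<close> at 1. The
    resulting linear inequality for \<open>u - 1\<close>, which is 0 at \<open>S\<close>, keeps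
    \<open>u\<close> from dropping below 1.\<close>
  define k where "k = a * f' 1"
  have "exp (k * S) * (u S - 1) \<le> exp (k * (S + d / 2)) * (u (S + d / 2) - 1)"
  proof (rule linear_differential_inequality)
    show "((\<lambda>t. k * t) has_real_derivative k) (at t)" for t
      by (auto intro!: derivative_eq_intros)
    show "((\<lambda>t. u t - 1) has_real_derivative v t) (at t)" for t
      by (auto intro!: derivative_eq_intros u_deriv)
    fix t assume "S < t" "t < S + d / 2"
    with nonneg[of t] \<open>d > 0\<close> have "0 \<le> v t + a * f (u t)" by (simp add: excess_def)
    also have "\<dots> \<le> v t + a * (f' 1 * (u t - 1))"
      using f_le_tangent[of "u t" 1] a(1) by (simp add: f_1)
    finally show "0 \<le> v t + k * (u t - 1)" by (simp add: k_def mult.assoc)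
  qed (use d in simp)
  then have "1 \<le> u (S + d / 2)"
    by (simp add: uS zero_le_mult_iff)
  with after[of "S + d / 2"] d(1) show False by simp
qed

lemma u_pos: "0 < u s"
proof (rule ccontr)
  assume s: "\<not> 0 < u s"
  define Z where "Z = {t. u t \<le> 0}"
  have "Z = u -` {..0}" by (auto simp: Z_def)
  then have "closed Z"
    using continuous_closed_vimage[of "{..0}" u] u_cont by simp
  obtain N where N: "\<And>t. t \<le> N \<Longrightarrow> 0 < u t"
    using order_tendstoD(1)[OF u_bot, of 0] by (auto simp: eventually_at_bot_linorder)
  then have bdd: "bdd_below Z"
    by (intro bdd_belowI[of _ N], unfold Z_def) (metis linear mem_Collect_eq not_less)
  \<comment> \<open>The first time at which \<open>u\<close> is not positive. Before it,
    \<open>v \<ge> - a * f u \<ge> - a * f' 0 * u\<close>, so \<open>u\<close> decays at most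
    exponentially and stays positive up to and including \<open>T\<close>.\<close>
  define T where "T = Inf Z"
  have "T \<in> Z"
    unfolding T_def using s bdd \<open>closed Z\<close>
    by (intro closed_contains_Inf) (auto simp: Z_def not_less)
  then have uT: "u T \<le> 0" by (simp add: Z_def)
  have before: "0 < u t" if "t < T" for t
    using cInf_lower[OF _ bdd, of t] that by (force simp: T_def Z_def)
  define k where "k = a * f' 0"
  have "exp (k * (T - 1)) * u (T - 1) \<le> exp (k * T) * u T"
  proof (rule linear_differential_inequality[OF _ u_deriv])
    show "((\<lambda>t. k * t) has_real_derivative k) (at t)" for t
      by (auto intro!: derivative_eq_intros)
    fix t assume "T - 1 < t" "t < T"
    then have "0 \<le> v t + a * f (u t)"
      using excess_a_pos[of t] before u_less_1 by (simp add: excess_def)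
    also have "\<dots> \<le> v t + a * (f' 0 * u t)"
      using f_le_tangent[of "u t" 0] a(1) by (simp add: f_0)
    finally show "0 \<le> v t + k * u t" by (simp add: k_def mult.assoc)
  qed simp
  moreover have "0 < exp (k * (T - 1)) * u (T - 1)"
    using before[of "T - 1"] by simp
  moreover have "exp (k * T) * u T \<le> 0"
    using uT by (simp add: mult_le_0_iff)
  ultimately show False by linarith
qed

section \<open>Bounds on \<open>v\<close> and the orbit as a graph over \<open>u\<close>\<close>

lemma f_u_pos: "0 < f (u s)"
  using f_pos u_pos u_less_1 by blast

lemma v_greater: "- a * f (u s) < v s"
  using excess_a_pos[of s] u_pos u_less_1 by (simp add: excess_def)

lemma v_less: "v s < - b * f (u s)"
  using excess_b_neg[of s] u_pos u_less_1 by (simp add: excess_def)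

lemma v_neg: "v s < 0"
  using v_less[of s] mult_pos_pos[OF b(1) f_u_pos[of s]] by simp

lemma u_less_iff: "u s < u t \<longleftrightarrow> t < s"
proof -
  have "u y < u x" if "x < y" for x y
    using DERIV_neg_imp_decreasing[OF that] u_deriv v_neg by blast
  then show ?thesis by (metis less_asym linorder_neqE)
qed

lemma u_le_iff: "u s \<le> u t \<longleftrightarrow> t \<le> s"
  using u_less_iff[of t s] by (simp add: not_less[symmetric])

lemma u_eq_iff: "u s = u t \<longleftrightarrow> s = t"
  using u_less_iff by (metis less_irrefl linorder_neqE)

lemma range_u: "range u = {0<..<1}"
proof
  show "range u \<subseteq> {0<..<1}" using u_pos u_less_1 by auto
  show "{0<..<1} \<subseteq> range u"
  proof
    fix x :: real assume x: "x \<in> {0<..<1}"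
    obtain p where p: "x < u p"
      using order_tendstoD(1)[OF u_bot, of x] x by (auto simp: eventually_at_bot_linorder)
    obtain q where q: "u q < x"
      using order_tendstoD(2)[OF u_top, of x] x by (auto simp: eventually_at_top_linorder)
    have "p \<le> q" using p q u_less_iff[of q p] by simp
    then show "x \<in> range u"
      using IVT2'[of u q x p] p q u_continuous_on by force
  qed
qed

lemma orbit_graph:
  obtains h where "{(0, 0), (1, 0)} \<union> range (\<lambda>s. (u s, v s)) = {(x, h x) | x. x \<in> {0..1}}"
    and "\<And>x. x \<in> {0<..<1} \<Longrightarrow> - a * f x < h x \<and> h x < - b * f x"
proof
  \<comment> \<open>Since \<open>u\<close> decreases strictly from 1 to 0, time can be eliminated.
    The default 0 supplies the two critical points at the ends.\<close>
  define h where "h = (\<lambda>x. if x \<in> {0<..<1} then v (inv u x) else 0)"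
  have hu: "h (u s) = v s" for s
    using inv_f_f[of u s] u_eq_iff u_pos[of s] u_less_1[of s] by (auto simp: h_def inj_on_def)
  have "{(x, h x) | x. x \<in> {0..1}} = (\<lambda>x. (x, h x)) ` ({0, 1} \<union> {0<..<1})"
    unfolding Setcompr_eq_image by (rule arg_cong[where f = "image _"]) auto
  also have "\<dots> = {(0, 0), (1, 0)} \<union> range (\<lambda>s. (u s, v s))"
    unfolding image_Un range_u[symmetric] image_image hu by (simp add: h_def)
  finally show "{(0, 0), (1, 0)} \<union> range (\<lambda>s. (u s, v s)) = {(x, h x) | x. x \<in> {0..1}}" ..
  fix x :: real assume "x \<in> {0<..<1}"
  then obtain s where "x = u s" unfolding range_u[symmetric] by blast
  then show "- a * f x < h x \<and> h x < - b * f x"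
    using v_greater v_less hu by simp
qed

section \<open>Time change and comparison with the scalar Cauchy problems\<close>

text \<open>The variable \<lambda> for which \<open>u\<close> satisfies the scalar equation
  \<open>u' = - \<lambda> * f u\<close> exactly.\<close>

definition speed_ratio :: "real \<Rightarrow> real" where
  "speed_ratio s = - v s / f (u s)"

lemma speed_ratio_bounds: "b < speed_ratio s" "speed_ratio s < a"
  using v_greater[of s] v_less[of s] f_u_pos[of s]
  by (auto simp: speed_ratio_def field_simps)

text \<open>\<open>K\<close> is the inverse of the integral \<open>G\<close> of
  \<open>speed_ratio\<close> from 0. In the new time, \<open>u\<close> solves the scalar equation
  with \<lambda> = 1, and the bounds on the ratio place \<open>G s\<close> between
  \<open>b * s\<close> and \<open>a * s\<close>.\<close>

lemma time_change:
  obtains K where "K 0 = 0"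
    and "\<And>x. (K has_real_derivative 1 / speed_ratio (K x)) (at x)"
    and "\<And>s. 0 \<le> s \<Longrightarrow> K (b * s) \<le> s \<and> s \<le> K (a * s)"
    and "\<And>s. s \<le> 0 \<Longrightarrow> K (a * s) \<le> s \<and> s \<le> K (b * s)"
proof -
  have "isCont speed_ratio s" for s
    unfolding speed_ratio_def using f_u_pos[of s]
    by (intro continuous_intros v_cont isCont_o2[OF u_cont f_cont]) simp
  then obtain G0 where G0: "\<And>s. (G0 has_real_derivative speed_ratio s) (at s)"
    using antiderivative_on_UNIV by blast
  define G where "G s = G0 s - G0 0" for s
  have G: "(G has_real_derivative speed_ratio s) (at s)" for s
    unfolding G_def by (auto intro!: derivative_eq_intros G0)
  have G_0: "G 0 = 0" by (simp add: G_def)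
  have ratio_pos: "0 < speed_ratio s" for s
    using speed_ratio_bounds[of s] b(1) by linarith
  have G_mono: "strict_mono G"
    using DERIV_pos_imp_increasing G ratio_pos by (blast intro: strict_monoI)
  have G_cont: "continuous_on S G" for S
    using DERIV_isCont[OF G] by (auto intro: continuous_at_imp_continuous_on)
  have incr: "b * (t - s) \<le> G t - G s \<and> G t - G s \<le> a * (t - s)" if "s \<le> t" for s t
  proof (cases "s = t")
    case False
    with that obtain z where "G t - G s = (t - s) * speed_ratio z"
      using MVT2[of s t G speed_ratio] G by force
    then show ?thesis
      using speed_ratio_bounds[of z] that
        mult_left_mono[of b "speed_ratio z" "t - s"] mult_left_mono[of "speed_ratio z" a "t - s"]
      by (simp add: mult.commute)
  qed auto
  have bounds_nonneg: "b * s \<le> G s \<and> G s \<le> a * s" if "0 \<le> s" for s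
    using incr[OF that] G_0 by simp
  have bounds_nonpos: "a * s \<le> G s \<and> G s \<le> b * s" if "s \<le> 0" for s
    using incr[OF that] G_0 by simp
  have "surj G"
  proof (rule surjI[where f = "\<lambda>x. SOME s. G s = x"], rule someI_ex)
    fix x
    \<comment> \<open>As \<open>G\<close> has slope at least \<open>b\<close>, it passes
      \<open>x\<close> between the times \<open>- \<bar>x\<bar> / b\<close> and
      \<open>\<bar>x\<bar> / b\<close>.\<close>
    have "x \<le> G (\<bar>x\<bar> / b)" "G (- \<bar>x\<bar> / b) \<le> x" "- \<bar>x\<bar> / b \<le> \<bar>x\<bar> / b"
      using bounds_nonneg[of "\<bar>x\<bar> / b"] bounds_nonpos[of "- \<bar>x\<bar> / b"] b(1) by auto
    with IVT'[of G "- \<bar>x\<bar> / b" x "\<bar>x\<bar> / b"] G_cont show "\<exists>s. G s = x"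
      by blast
  qed
  define K where "K = inv G"
  have KG: "K (G s) = s" for s
    unfolding K_def using G_mono by (simp add: strict_mono_imp_inj_on)
  have GK: "G (K x) = x" for x
    unfolding K_def using \<open>surj G\<close> by (rule surj_f_inv_f)
  have K_le: "K x \<le> s \<longleftrightarrow> x \<le> G s" "s \<le> K x \<longleftrightarrow> G s \<le> x" for x s
    using strict_mono_less_eq[OF G_mono, of "K x" s] strict_mono_less_eq[OF G_mono, of s "K x"] GK
    by simp_all
  show ?thesis
  proof
    show "K 0 = 0" using KG[of 0] by (simp add: G_0)
    show "(K has_real_derivative 1 / speed_ratio (K x)) (at x)" for x
      unfolding has_field_derivative_def
      by (rule has_derivative_inverse_strong_x[of UNIV K x G "(*) (speed_ratio (K x))"])
        (use G[of "K x"] ratio_pos[of "K x"] G_cont KG GK in \<open>auto simp: has_field_derivative_def\<close>)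
    show "K (b * s) \<le> s \<and> s \<le> K (a * s)" if "0 \<le> s" for s
      using bounds_nonneg[OF that] K_le by simp
    show "K (a * s) \<le> s \<and> s \<le> K (b * s)" if "s \<le> 0" for s
      using bounds_nonpos[OF that] K_le by simp
  qed
qed

text \<open>As \<open>u\<close> is decreasing, the bounds on \<open>K\<close> compare
  \<open>u s\<close> with \<open>u (K (a * s))\<close> and \<open>u (K (b * s))\<close>. Their order
  flips at \<open>s = 0\<close>.\<close>

lemma u_between_cauchy_solutions:
  assumes "u 0 = 1 / 2"
  shows "u s \<in> closed_segment (cauchy_solution f a s) (cauchy_solution f b s)"
proof -
  obtain K where K: "K 0 = 0" "\<And>x. (K has_real_derivative 1 / speed_ratio (K x)) (at x)"
    "\<And>s. 0 \<le> s \<Longrightarrow> K (b * s) \<le> s \<and> s \<le> K (a * s)"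
    "\<And>s. s \<le> 0 \<Longrightarrow> K (a * s) \<le> s \<and> s \<le> K (b * s)"
    using time_change by blast
  \<comment> \<open>For every \<open>l\<close>, the factor \<open>speed_ratio\<close> cancels in the
    chain rule, and uniqueness identifies the description \<open>THE\<close>.\<close>
  have cauchy: "cauchy_solution f l = (\<lambda>s. u (K (l * s)))" for l
    unfolding cauchy_solution_def
  proof (rule the_equality)
    have D: "((\<lambda>s. u (K (l * s))) has_real_derivative - l * f (u (K (l * s)))) (at s)" for s
    proof -
      have "((\<lambda>s. l * s) has_real_derivative l) (at s)"
        by (auto intro!: derivative_eq_intros)
      from DERIV_chain2[OF u_deriv DERIV_chain2[OF K(2) this]] show ?thesis
        using v_neg[of "K (l * s)"] f_u_pos[of "K (l * s)"] by (simp add: speed_ratio_def field_simps)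
    qed
    then show sol: "u (K (l * 0)) = 1 / 2 \<and>
        (\<forall>s. ((\<lambda>s. u (K (l * s))) has_real_derivative - l * f (u (K (l * s)))) (at s))"
      using assms K(1) by simp
    show "z = (\<lambda>s. u (K (l * s)))"
      if "z 0 = 1 / 2 \<and> (\<forall>s. (z has_real_derivative - l * f (z s)) (at s))" for z
      by (rule autonomous_ode_unique[OF f_deriv f'_cont, of z "- l"]) (use sol that in auto)
  qed
  show ?thesis
    using K(3,4)[of s] u_le_iff by (cases "0 \<le> s") (auto simp: cauchy closed_segment_eq_real_ivl)
qed

end

text \<open>Rationalizing gives \<open>l * (c + r) = 2\<close> with \<open>r\<close> the square
  root, which makes \<open>l\<close> positive whatever the sign of \<open>d\<close>.\<close>

lemma quadratic_root:
  fixes c d :: real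
  assumes "0 < c" "d \<noteq> 0" "4 * d \<le> c\<^sup>2"
  defines "l \<equiv> (c - sqrt (c\<^sup>2 - 4 * d)) / (2 * d)"
  shows "0 < l" and "l\<^sup>2 * d - c * l + 1 = 0"
proof -
  define r where "r = sqrt (c\<^sup>2 - 4 * d)"
  have r: "0 \<le> r" "r\<^sup>2 = c\<^sup>2 - 4 * d"
    using assms(3) by (simp_all add: r_def)
  have l: "l * (2 * d) = c - r"
    using assms(2) by (simp add: l_def r_def)
  have "(2 * d) * (l * (c + r)) = (c - r) * (c + r)"
    unfolding l[symmetric] by simp
  also have "\<dots> = (2 * d) * 2"
    using r(2) by (simp add: algebra_simps power2_eq_square)
  finally have "l * (c + r) = 2"
    using assms(2) by simp
  then show "0 < l"
    using r(1) assms(1) by (smt (verit) zero_less_mult_pos2)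
  have "2 * (l\<^sup>2 * d - c * l + 1) = l * (l * (2 * d)) - 2 * c * l + 2"
    by (simp add: algebra_simps power2_eq_square)
  also have "\<dots> = 0"
    unfolding l using \<open>l * (c + r) = 2\<close> by (simp add: algebra_simps)
  finally show "l\<^sup>2 * d - c * l + 1 = 0" by simp
qed

text \<open>The bound on \<open>c\<close> makes the discriminant at 0 nonnegative; at 1 this follows
  from \<open>deriv f 1 < 0\<close>.\<close>

lemma concave_front_of_time_parametrization:
  assumes "smooth_fun f" "f 0 = 0" "f 1 = 0" "deriv f 0 > 0" "deriv f 1 < 0"
    and concave: "\<forall>u. deriv (deriv f) u < 0"
    and c: "c \<ge> 2 * sqrt (deriv f 0)"
    and uv: "time_parametrization f c H u v"
  shows "concave_front f (deriv f) c (lambda_lower f c) (lambda_upper f c) u v"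
proof -
  have "(deriv ^^ n) f field_differentiable (at x)" for n x
    using assms(1) by (simp add: smooth_fun_def)
  from this[of 0] this[of 1]
  have f: "(f has_real_derivative deriv f x) (at x)"
    and f': "(deriv f has_real_derivative deriv (deriv f) x) (at x)" for x
    by (simp_all add: DERIV_deriv_iff_field_differentiable)
  have "0 < c"
    using c assms(4) by (smt (verit) real_sqrt_gt_zero)
  have "(2 * sqrt (deriv f 0))\<^sup>2 \<le> c\<^sup>2"
    using c assms(4) by (intro power_mono) auto
  then have "4 * deriv f 0 \<le> c\<^sup>2"
    using assms(4) by (simp add: power_mult_distrib)
  moreover have "4 * deriv f 1 \<le> c\<^sup>2"
    using assms(5) by (smt (verit) zero_le_power2)
  ultimately have roots:
    "0 < lambda_lower f c" "(lambda_lower f c)\<^sup>2 * deriv f 0 - c * lambda_lower f c + 1 = 0"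
    "0 < lambda_upper f c" "(lambda_upper f c)\<^sup>2 * deriv f 1 - c * lambda_upper f c + 1 = 0"
    using quadratic_root[OF \<open>0 < c\<close>] assms(4,5)
    unfolding lambda_lower_def lambda_upper_def by simp_all
  have bot: "((\<lambda>s. (u s, v s)) \<longlongrightarrow> (1, 0)) at_bot" and top: "((\<lambda>s. (u s, v s)) \<longlongrightarrow> (0, 0)) at_top"
    using uv by (simp_all add: time_parametrization_def)
  show ?thesis
  proof
    show "isCont (deriv f) x" for x using f' DERIV_isCont by blast
    show "deriv f y < deriv f x" if "x < y" for x y
      using DERIV_neg_imp_decreasing[OF that] f' concave by blast
    show "(u has_real_derivative v s) (at s)" "(v has_real_derivative - c * v s - f (u s)) (at s)" for s
      using uv by (simp_all add: time_parametrization_def solves_system_def)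
  qed (use assms f roots \<open>0 < c\<close> tendsto_fst[OF bot] tendsto_snd[OF bot] tendsto_fst[OF top] in simp_all)
qed

theorem theorem1p1:
  fixes f :: "real \<Rightarrow> real" and c :: real and H :: "(real \<times> real) set"
  assumes "smooth_fun f"
    and "f 0 = 0" and "f 1 = 0"
    and "deriv f 0 > 0" and "deriv f 1 < 0"
    and "\<forall>u. deriv (deriv f) u < 0"
    and "c \<ge> 2 * sqrt (deriv f 0)"
    and "heteroclinic_orbit f c H"
  shows "(\<exists>h :: real \<Rightarrow> real. H = {(u, h u) | u. u \<in> {0..1}} \<and>
            (\<forall>u\<in>{0<..<1}. - lambda_lower f c * f u < h u \<and>
                           h u < - lambda_upper f c * f u \<and>
                           - lambda_upper f c * f u < 0)) \<and>
         (\<forall>u v. time_parametrization f c H u v \<and> u 0 = 1/2 \<longrightarrow>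
            (\<forall>s. u s \<in> closed_segment (cauchy_solution f (lambda_lower f c) s)
                                       (cauchy_solution f (lambda_upper f c) s)))"
proof (intro conjI allI impI)
  \<comment> \<open>\<open>front\<close> stays general in \<open>u\<close> and \<open>v\<close>: one
    parametrization describes \<open>H\<close>, but the last claim concerns all of them.\<close>
  note front = concave_front_of_time_parametrization[OF assms(1-7)]
  obtain u v where uv: "time_parametrization f c H u v"
    using assms(8) by (auto simp: heteroclinic_orbit_def)
  interpret concave_front f "deriv f" c "lambda_lower f c" "lambda_upper f c" u v
    by (rule front[OF uv])
  have H: "H = {(0, 0), (1, 0)} \<union> range (\<lambda>s. (u s, v s))"
    using uv by (simp add: time_parametrization_def)
  have "- lambda_upper f c * f x < 0" if "x \<in> {0<..<1}" for x
    using that f_pos b(1) by simp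
  moreover obtain h where "H = {(x, h x) | x. x \<in> {0..1}}"
    "\<And>x. x \<in> {0<..<1} \<Longrightarrow> - lambda_lower f c * f x < h x \<and> h x < - lambda_upper f c * f x"
    by (rule orbit_graph[folded H]) blast
  ultimately show "\<exists>h. H = {(u, h u) | u. u \<in> {0..1}} \<and>
      (\<forall>u\<in>{0<..<1}. - lambda_lower f c * f u < h u \<and> h u < - lambda_upper f c * f u \<and>
                     - lambda_upper f c * f u < 0)"
    by (intro exI[of _ h] conjI ballI) simp_all
  show "u s \<in> closed_segment (cauchy_solution f (lambda_lower f c) s) (cauchy_solution f (lambda_upper f c) s)"
    if "time_parametrization f c H u v \<and> u 0 = 1/2" for u v s
    by (rule concave_front.u_between_cauchy_solutions[OF front[OF conjunct1[OF that]] conjunct2[OF that]])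
qed

end
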